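(* Let $P,R$ be finite index sets and let $\mu_p>0$, $\sigma_p^2\ge 0$ $(p\in P)$, $\lambda_r\ge 0$ $(r\in R)$ and $U_{p,r}\ge 0$ $(p\in P,r\in R)$ be given constants. Let $X=(X_p)_{p\in P}$ and $Y=(Y_{p,r})_{p\in P,r\in R}$ be real vectors satisfying $$\sum_{p\in P}\sum_{r\in R}\lambda_rY_{p,r}\le\sum_{p\in P}\mu_pX_p,\qquad \sum_{p\in P}X_p=1,\qquad X_p\in\{0,1\}\ (p\in P),\qquad 0\le Y_{p,r}\le U_{p,r}X_p\ (p\in P,\ r\in R),$$ and let $RH$ be a real number (the value of a constant, a variable, or an affine function of the decision variables). Let $PM(X,Y)$ be the expected waiting time in the system $W$ of the M/G/1 queue with arrival rate $\lambda=\sum_{p\in P}\sum_{r\in R}\lambda_rY_{p,r}$, service rate $\mu=\sum_{p\in P}\mu_pX_p$ and service-time variance $\sigma^2=\sum_{p\in P}\sigma_p^2X_p$. Then: (a) The constraint $PM(X,Y)\le RH$ holds if and only if there exist real numbers $s_p$, $p\in P$, such that $$\sum_{p\in P}\left[\frac{(1+\mu_p^2\sigma_p^2)\,s_p}{2\mu_p}+\frac{X_p}{\mu_p}\right]\le RH,$$ $$\Big(\sum_{r\in R}\lambda_rY_{p,r}\Big)^2\le\Big(s_p\mu_p-\sum_{r\in R}\lambda_rY_{p,r}\Big)\Big(\mu_p-\sum_{r\in R}\lambda_rY_{p,r}\Big)\ (p\in P),\qquad s_p\ge0\ (p\in P).$$ (b) If moreover $Y_{p,r}\in\{0,1\}$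 for all $p\in P$, $r\in R$, then $PM(X,Y)\le RH$ holds if and only if there exist real numbers $s_p$, $p\in P$, such that $$\sum_{p\in P}\left[\frac{(1+\mu_p^2\sigma_p^2)\,s_p}{2\mu_p}+\frac{X_p}{\mu_p}\right]\le RH,$$ $$\sum_{r\in R}\lambda_rY_{p,r}^2\le s_p\Big(\mu_p-\sum_{r\in R}\lambda_rY_{p,r}\Big)\ (p\in P),\qquad s_p\ge0\ (p\in P).$$
   Context: For an M/G/1 queue with arrival rate $\lambda\ge0$, service rate $\mu>0$ (the reciprocal of the mean service time), service-time variance $\sigma^2$ and utilization $\rho=\lambda/\mu<1$, the expected time $W$ a customer spends in the system is taken to be given by the formula $$W=\frac{\rho+\lambda\mu\sigma^2}{2(\mu-\lambda)}+\frac1\mu.$$ Stability $\rho<1$ is a standing assumption; in the boundary case $\lambda=\mu$ the metric is regarded as $+\infty$, so that the constraint $PM(X,Y)\le RH$ fails. *)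

theory Defs
  imports Complex_Main "HOL-Library.Extended_Real"
begin

definition mg1_utilization :: "real \<Rightarrow> real \<Rightarrow> real" where
  "mg1_utilization lam mu = lam / mu"

text \<open>
  Expected time in the system of an M/G/1 queue with arrival rate \<open>lam\<close>, service rate
  \<open>mu > 0\<close> and service-time variance \<open>var\<close> (the variance itself, not the
  standard deviation). The formula is meaningful only for a stable queue; without stability, in
  particular for \<open>lam = mu\<close>, the value is infinite. The type is \<^typ>\<open>ereal\<close> so that
  division by zero in the formula never produces a finite value at the boundary.
\<close>

definition mg1_system_time :: "real \<Rightarrow> real \<Rightarrow> real \<Rightarrow> ereal" where
  "mg1_system_time lam mu var =
     (if mg1_utilization lam mu < 1
      then ereal ((mg1_utilization lam mu + lam * mu * var) / (2 * (mu - lam)) + 1 / mu)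
      else \<infinity>)"

definition PM ::
  "'p set \<Rightarrow> 'r set \<Rightarrow> ('p \<Rightarrow> real) \<Rightarrow> ('p \<Rightarrow> real) \<Rightarrow> ('r \<Rightarrow> real)
    \<Rightarrow> ('p \<Rightarrow> real) \<Rightarrow> ('p \<Rightarrow> 'r \<Rightarrow> real) \<Rightarrow> ereal" where
  "PM P R mu var lam X Y =
     mg1_system_time (\<Sum>p\<in>P. \<Sum>r\<in>R. lam r * Y p r) (\<Sum>p\<in>P. mu p * X p) (\<Sum>p\<in>P. var p * X p)"

end

theory Submission
  imports Defs
begin

text \<open>
  Exactly one \<open>q\<close> has \<open>X q = 1\<close>, and only its load \<open>a = (\<Sum>r\<in>R. lam r * Y q r)\<close> can be
  nonzero. Writing \<open>m = mu q\<close> and \<open>v = var q\<close>, the system time is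
  \<open>(1 + m\<^sup>2 v) / (2 m) \<cdot> a / (m - a) + 1 / m\<close>, which is increasing in \<open>a / (m - a)\<close>. Both conic
  constraints say \<open>a \<le> s (m - a)\<close>: in (a) the term \<open>a\<^sup>2\<close> cancels and one divides by \<open>m\<close>,
  in (b) \<open>Y\<^sup>2 = Y\<close>. This inequality has no solution at \<open>a = m\<close>, where the queue is unstable, and
  otherwise its least solution is \<open>s = a / (m - a)\<close>.
\<close>

text \<open>This brings the formula into the shape of one cost summand with \<open>X p = 1\<close>:
  the factor \<open>a / (m - a)\<close> stands where \<open>s p\<close> will stand.\<close>

lemma mg1_system_time_stable:
  assumes "0 < m" "a < m"
  shows "mg1_system_time a m v = ereal ((1 + m\<^sup>2 * v) * (a / (m - a)) / (2 * m) + 1 / m)"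
proof -
  have "(a / m + a * m * v) / (2 * (m - a)) = (1 + m\<^sup>2 * v) * (a / (m - a)) / (2 * m)"
    using assms by (simp add: divide_simps) (simp add: algebra_simps power2_eq_square)
  then show ?thesis
    using assms by (simp add: mg1_system_time_def mg1_utilization_def)
qed

lemma square_le_product_iff:
  fixes a m s :: real
  assumes "0 < m"
  shows "a\<^sup>2 \<le> (s * m - a) * (m - a) \<longleftrightarrow> a \<le> s * (m - a)"
proof -
  have "(s * m - a) * (m - a) - a\<^sup>2 = m * (s * (m - a) - a)"
    by (simp add: algebra_simps power2_eq_square)
  then have "a\<^sup>2 \<le> (s * m - a) * (m - a) \<longleftrightarrow> 0 \<le> m * (s * (m - a) - a)"
    by linarith
  also have "\<dots> \<longleftrightarrow> a \<le> s * (m - a)"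
    using assms by (simp add: zero_le_mult_iff)
  finally show ?thesis .
qed

text \<open>Once an index of value 1 is removed, the remaining values are nonnegative with sum 0, so
  each of them vanishes.\<close>

lemma unit_vector_of_sum_one:
  fixes X :: "'p \<Rightarrow> real"
  assumes "finite P" "(\<Sum>p\<in>P. X p) = 1" "\<forall>p\<in>P. X p \<in> {0, 1}"
  obtains q where "q \<in> P" "X q = 1" "\<And>p. p \<in> P - {q} \<Longrightarrow> X p = 0"
proof -
  obtain q where q: "q \<in> P" "X q \<noteq> 0"
    using assms(2) sum.neutral[of P X] by (metis zero_neq_one)
  then have "X q = 1"
    using assms(3) by auto
  moreover from this have "sum X (P - {q}) = 0"
    using assms(1,2) q(1) by (simp add: sum.remove)
  then have "\<forall>p\<in>P - {q}. X p = 0"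
    using assms(1,3) by (subst (asm) sum_nonneg_eq_0_iff) auto
  ultimately show thesis
    using that q(1) by blast
qed

text \<open>The common core of (a) and (b): the inner sums are abstracted to a load
  \<open>a p\<close>, and the cone is in the linear form to which both conic constraints
  reduce.\<close>

lemma mg1_system_time_le_iff:
  fixes P :: "'p set" and mu var a X :: "'p \<Rightarrow> real" and q :: 'p and RH :: real
  assumes fin: "finite P" and q: "q \<in> P"
    and mu: "\<forall>p\<in>P. 0 < mu p" and var: "\<forall>p\<in>P. 0 \<le> var p"
    and X: "X q = 1" "\<And>p. p \<in> P - {q} \<Longrightarrow> X p = 0"
    and a: "0 \<le> a q" "a q \<le> mu q" "\<And>p. p \<in> P - {q} \<Longrightarrow> a p = 0"
  shows "mg1_system_time (a q) (mu q) (var q) \<le> ereal RH \<longleftrightarrow>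
    (\<exists>s. (\<Sum>p\<in>P. (1 + (mu p)\<^sup>2 * var p) * s p / (2 * mu p) + X p / mu p) \<le> RH \<and>
         (\<forall>p\<in>P. a p \<le> s p * (mu p - a p)) \<and> (\<forall>p\<in>P. 0 \<le> s p))"
    (is "_ \<longleftrightarrow> (\<exists>s. ?cost s \<le> RH \<and> ?cone s \<and> ?nonneg s)")
proof
  assume le: "mg1_system_time (a q) (mu q) (var q) \<le> ereal RH"
  \<comment> \<open>An unstable queue has the value \<infinity>, which no real \<open>RH\<close>
    bounds.\<close>
  have stable: "a q < mu q"
    using le q mu by (auto simp: mg1_system_time_def mg1_utilization_def split: if_splits)
  \<comment> \<open>The least choice, making the cone tight at \<open>q\<close>. Elsewhere the load
    is 0, hence so is \<open>s p\<close>, and only the cost summand at \<open>q\<close>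
    survives.\<close>
  define s where "s p = a p / (mu p - a p)" for p
  have s0: "s p = 0" if "p \<in> P - {q}" for p
    using that a(3) by (simp add: s_def)
  have "?cost s = (1 + (mu q)\<^sup>2 * var q) * s q / (2 * mu q) + 1 / mu q"
    using fin q X s0 by (simp add: sum.remove)
  also have "\<dots> \<le> RH"
    using le stable q mu by (simp add: mg1_system_time_stable s_def)
  finally have "?cost s \<le> RH" .
  moreover have "a p \<le> s p * (mu p - a p) \<and> 0 \<le> s p" if "p \<in> P" for p
    using that stable a by (cases "p = q") (auto simp: s_def)
  ultimately show "\<exists>s. ?cost s \<le> RH \<and> ?cone s \<and> ?nonneg s"
    by blast
next
  assume "\<exists>s. ?cost s \<le> RH \<and> ?cone s \<and> ?nonneg s"
  then obtain s where cost: "?cost s \<le> RH" and cone: "?cone s" and nonneg: "?nonneg s"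
    by blast
  have coeff: "0 \<le> 1 + (mu p)\<^sup>2 * var p" if "p \<in> P" for p
    using that var by simp
  \<comment> \<open>Equality would turn the cone at \<open>q\<close> into
    \<open>mu q \<le> 0\<close>.\<close>
  have "a q \<noteq> mu q"
    using cone q mu by force
  then have stable: "a q < mu q"
    using a(2) by simp
  have "a q / (mu q - a q) \<le> s q"
    using cone q stable by (simp add: pos_divide_le_eq)
  then have "(1 + (mu q)\<^sup>2 * var q) * (a q / (mu q - a q)) / (2 * mu q) + 1 / mu q
      \<le> (1 + (mu q)\<^sup>2 * var q) * s q / (2 * mu q) + X q / mu q"
    using coeff[OF q] q mu X by (intro add_mono divide_right_mono mult_left_mono) (auto simp: less_imp_le)
  \<comment> \<open>All summands are nonnegative, so the one at \<open>q\<close> is at most the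
    whole sum, whatever \<open>s\<close> is elsewhere.\<close>
  also have "\<dots> \<le> ?cost s"
    using fin q coeff nonneg mu X
    by (intro member_le_sum) (auto intro!: divide_nonneg_pos mult_nonneg_nonneg)
  finally show "mg1_system_time (a q) (mu q) (var q) \<le> ereal RH"
    using cost stable q mu by (simp add: mg1_system_time_stable)
qed

theorem theorem2:
  fixes P :: "'p set" and R :: "'r set"
    and mu var :: "'p \<Rightarrow> real" and lam :: "'r \<Rightarrow> real"
    and U Y :: "'p \<Rightarrow> 'r \<Rightarrow> real" and X :: "'p \<Rightarrow> real" and RH :: real
  assumes "finite P" and "finite R"
    and "\<forall>p\<in>P. mu p > 0" and "\<forall>p\<in>P. var p \<ge> 0"
    and "\<forall>r\<in>R. lam r \<ge> 0" and "\<forall>p\<in>P. \<forall>r\<in>R. U p r \<ge> 0"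
    and "(\<Sum>p\<in>P. \<Sum>r\<in>R. lam r * Y p r) \<le> (\<Sum>p\<in>P. mu p * X p)"
    and "(\<Sum>p\<in>P. X p) = 1"
    and "\<forall>p\<in>P. X p \<in> {0, 1}"
    and "\<forall>p\<in>P. \<forall>r\<in>R. 0 \<le> Y p r \<and> Y p r \<le> U p r * X p"
  shows
    "(PM P R mu var lam X Y \<le> ereal RH \<longleftrightarrow>
       (\<exists>s :: 'p \<Rightarrow> real.
          (\<Sum>p\<in>P. (1 + (mu p)\<^sup>2 * var p) * s p / (2 * mu p) + X p / mu p) \<le> RH \<and>
          (\<forall>p\<in>P. (\<Sum>r\<in>R. lam r * Y p r)\<^sup>2
             \<le> (s p * mu p - (\<Sum>r\<in>R. lam r * Y p r)) * (mu p - (\<Sum>r\<in>R. lam r * Y p r))) \<and>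
          (\<forall>p\<in>P. s p \<ge> 0)))
     \<and>
     ((\<forall>p\<in>P. \<forall>r\<in>R. Y p r \<in> {0, 1}) \<longrightarrow>
       (PM P R mu var lam X Y \<le> ereal RH \<longleftrightarrow>
         (\<exists>s :: 'p \<Rightarrow> real.
            (\<Sum>p\<in>P. (1 + (mu p)\<^sup>2 * var p) * s p / (2 * mu p) + X p / mu p) \<le> RH \<and>
            (\<forall>p\<in>P. (\<Sum>r\<in>R. lam r * (Y p r)\<^sup>2)
               \<le> s p * (mu p - (\<Sum>r\<in>R. lam r * Y p r))) \<and>
            (\<forall>p\<in>P. s p \<ge> 0))))"
proof -
  let ?a = "\<lambda>p. \<Sum>r\<in>R. lam r * Y p r"
  obtain q where q: "q \<in> P" "X q = 1" and X0: "\<And>p. p \<in> P - {q} \<Longrightarrow> X p = 0"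
    using unit_vector_of_sum_one[OF \<open>finite P\<close> assms(8,9)] by blast
  have a0: "?a p = 0" if "p \<in> P - {q}" for p
  proof -
    \<comment> \<open>With \<open>X p = 0\<close> the upper bound \<open>U p r * X p\<close> is 0
      and meets the lower bound.\<close>
    have "Y p r = 0" if "r \<in> R" for r
      using assms(10) X0 \<open>p \<in> P - {q}\<close> that by (metis DiffD1 mult_zero_right order_antisym)
    then show ?thesis by simp
  qed
  have total: "(\<Sum>p\<in>P. ?a p) = ?a q" "(\<Sum>p\<in>P. mu p * X p) = mu q" "(\<Sum>p\<in>P. var p * X p) = var q"
    using \<open>finite P\<close> q X0 a0 by (simp_all add: sum.remove)
  have "0 \<le> ?a q"
    using assms(5,10) q by (intro sum_nonneg) simp
  moreover have "?a q \<le> mu q"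
    using assms(7) unfolding total .
  ultimately have key: "PM P R mu var lam X Y \<le> ereal RH \<longleftrightarrow>
    (\<exists>s. (\<Sum>p\<in>P. (1 + (mu p)\<^sup>2 * var p) * s p / (2 * mu p) + X p / mu p) \<le> RH \<and>
         (\<forall>p\<in>P. ?a p \<le> s p * (mu p - ?a p)) \<and> (\<forall>p\<in>P. 0 \<le> s p))"
    unfolding PM_def total
    by (intro mg1_system_time_le_iff assms(1,3,4) q X0 a0)
  \<comment> \<open>The cones agree for each fixed \<open>s\<close>, so the same witnesses serve
    both existential statements.\<close>
  have cone_a: "(\<forall>p\<in>P. (?a p)\<^sup>2 \<le> (s p * mu p - ?a p) * (mu p - ?a p)) \<longleftrightarrow>
      (\<forall>p\<in>P. ?a p \<le> s p * (mu p - ?a p))" for s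
    using assms(3) square_le_product_iff by blast
  have cone_b: "(\<forall>p\<in>P. (\<Sum>r\<in>R. lam r * (Y p r)\<^sup>2) \<le> s p * (mu p - ?a p)) \<longleftrightarrow>
      (\<forall>p\<in>P. ?a p \<le> s p * (mu p - ?a p))" if "\<forall>p\<in>P. \<forall>r\<in>R. Y p r \<in> {0, 1}" for s
  proof -
    have "(\<Sum>r\<in>R. lam r * (Y p r)\<^sup>2) = ?a p" if "p \<in> P" for p
      using \<open>\<forall>p\<in>P. \<forall>r\<in>R. Y p r \<in> {0, 1}\<close> that by (intro sum.cong refl) force
    then show ?thesis by simp
  qed
  show ?thesis
    unfolding key cone_a by (simp add: cone_b)
qed

end
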